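(* Let $\epsilon>0$. For every $v\in\langle\cdot\rangle^{\epsilon-2}L^2(\mathbb{C})$ there exists $u\in\langle\cdot\rangle^{\epsilon}L^2(\mathbb{C})$ such that $\overline{\partial}u=v$ and $$\|\langle\cdot\rangle^{-\epsilon}u\|_{L^2}\le \epsilon^{-1/2}\,\|\langle\cdot\rangle^{2-\epsilon}v\|_{L^2}.$$
   Context: For $z=x+iy\in\mathbb{C}$ put $\langle z\rangle=(1+|z|^2)^{1/2}$. For $\theta\in\mathbb{R}$, $\langle\cdot\rangle^{\theta}L^2=\langle\cdot\rangle^\theta L^2(\mathbb{C})=\{\langle z\rangle^{\theta}u(z):\ u\in L^2(\mathbb{C})\}$, where $L^2(\mathbb{C})$ is taken with respect to Lebesgue measure on $\mathbb{C}\simeq\mathbb{R}^2$. The operator is $\overline{\partial}=\frac12(\partial_x+i\partial_y)$, and the equation $\overline\partial u=v$ is understood in the sense of distributions. *)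

theory Defs
  imports "HOL-Analysis.Analysis"
begin

definition japanese :: "complex \<Rightarrow> real" where
  "japanese z = sqrt (1 + (cmod z)\<^sup>2)"

text \<open>Elements of \<open>L\<^sup>2\<close> are represented by functions, not by classes modulo null sets.\<close>

definition L2 :: "(complex \<Rightarrow> complex) set" where
  "L2 = {f \<in> borel_measurable lebesgue. integrable lebesgue (\<lambda>z. (cmod (f z))\<^sup>2)}"

text \<open>The norm is meaningful only on \<^const>\<open>L2\<close>: elsewhere the integral has the default value 0.\<close>

definition L2_norm :: "(complex \<Rightarrow> complex) \<Rightarrow> real" where
  "L2_norm f = sqrt (\<integral>z. (cmod (f z))\<^sup>2 \<partial>lebesgue)"

definition weight :: "real \<Rightarrow> (complex \<Rightarrow> complex) \<Rightarrow> complex \<Rightarrow> complex" where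
  "weight \<theta> f = (\<lambda>z. (japanese z powr \<theta>) *\<^sub>R f z)"

definition weighted_L2 :: "real \<Rightarrow> (complex \<Rightarrow> complex) set" where
  "weighted_L2 \<theta> = weight \<theta> ` L2"

text \<open>Differentiability below is real: the Frechet derivative of a function on the real vector
  space \<open>complex\<close>, evaluated in the directions \<open>1\<close> and \<open>\<i>\<close>.\<close>

definition partial_x :: "(complex \<Rightarrow> complex) \<Rightarrow> complex \<Rightarrow> complex" where
  "partial_x f z = frechet_derivative f (at z) 1"

definition partial_y :: "(complex \<Rightarrow> complex) \<Rightarrow> complex \<Rightarrow> complex" where
  "partial_y f z = frechet_derivative f (at z) \<i>"

definition dbar :: "(complex \<Rightarrow> complex) \<Rightarrow> complex \<Rightarrow> complex" where
  "dbar f z = (partial_x f z + \<i> * partial_y f z) / 2"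

primrec Ck :: "nat \<Rightarrow> (complex \<Rightarrow> complex) \<Rightarrow> bool" where
  "Ck 0 f \<longleftrightarrow> continuous_on UNIV f"
| "Ck (Suc k) f \<longleftrightarrow> (\<forall>z. f differentiable at z) \<and> Ck k (partial_x f) \<and> Ck k (partial_y f)"

definition test_functions :: "(complex \<Rightarrow> complex) set" where
  "test_functions = {\<phi>. (\<forall>k. Ck k \<phi>) \<and> compact (closure {z. \<phi> z \<noteq> 0})}"

definition locally_integrable :: "(complex \<Rightarrow> complex) \<Rightarrow> bool" where
  "locally_integrable f \<longleftrightarrow> (\<forall>K. compact K \<longrightarrow> set_integrable lebesgue K f)"

text \<open>The equation \<open>dbar u = v\<close> in the sense of distributions. Local integrability is part of the
  definition so that both integrals exist for every test function.\<close>

definition dbar_distributional :: "(complex \<Rightarrow> complex) \<Rightarrow> (complex \<Rightarrow> complex) \<Rightarrow> bool" where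
  "dbar_distributional u v \<longleftrightarrow> locally_integrable u \<and> locally_integrable v \<and>
     (\<forall>\<phi>\<in>test_functions. (\<integral>z. u z * dbar \<phi> z \<partial>lebesgue) = - (\<integral>z. v z * \<phi> z \<partial>lebesgue))"

end

theory Submission
  imports Defs
begin

text \<open>The proof is Hormander's duality argument for the weight \<open>\<psi> = \<epsilon> log (1 + |z|\<^sup>2)\<close>, for which
  \<open>\<partial>\<^sub>z \<partial>\<^sub>z\<^sub>' \<psi> = \<epsilon> / (1 + |z|\<^sup>2)\<^sup>2\<close> (a prime stands for the conjugate). For a test function \<open>\<phi>\<close>, integration by
  parts gives
  \<open>\<integral> |dbar \<phi>|\<^sup>2 exp \<psi> = \<integral> |\<partial>\<^sub>z \<phi> + \<phi> \<partial>\<^sub>z \<psi>|\<^sup>2 exp \<psi> + \<epsilon> \<integral> |\<phi>|\<^sup>2 (1 + |z|\<^sup>2) powr (\<epsilon> - 2)\<close>.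
  By the Cauchy--Schwarz inequality the functional \<open>dbar \<phi> \<mapsto> - \<integral> v \<phi>\<close> is therefore bounded for the norm
  of \<open>L\<^sup>2(exp \<psi>)\<close>, with the constant of the theorem, and the Riesz representation of this functional is \<open>u\<close>.\<close>

subsection \<open>Mixed derivatives and integration by parts\<close>

text \<open>Restriction to the line through \<open>x\<close> in direction \<open>h\<close> reduces
  this to the mean value inequality in one variable. It later dominates difference
  quotients.\<close>

lemma directional_derivative_bound:
  fixes f :: "'a::real_normed_vector \<Rightarrow> 'b::real_normed_vector"
  assumes f: "\<And>x. (f has_derivative f' x) (at x)"
    and B: "\<And>t. 0 \<le> t \<Longrightarrow> t \<le> T \<Longrightarrow> norm (f' (x + t *\<^sub>R h) h) \<le> B"
    and "0 \<le> T"
  shows "norm (f (x + T *\<^sub>R h) - f x) \<le> B * T"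
proof (cases "T = 0")
  case False
  have *: "((\<lambda>t. f (x + t *\<^sub>R h)) has_vector_derivative f' (x + t *\<^sub>R h) h) (at t)" for t
    unfolding has_vector_derivative_def
    by (rule has_derivative_eq_rhs, rule has_derivative_compose[OF _ f])
      (auto intro!: derivative_eq_intros simp: linear_cmul[OF has_derivative_linear[OF f]])
  have "norm (f (x + T *\<^sub>R h) - f (x + 0 *\<^sub>R h)) \<le> B * T - B * 0"
  proof (rule differentiable_bound_general)
    show "continuous_on {0..T} (\<lambda>t. f (x + t *\<^sub>R h))"
      using * by (meson continuous_at_imp_continuous_on has_vector_derivative_continuous)
    show "((\<lambda>t. B * t) has_vector_derivative B) (at t)" for t
      by (auto intro!: derivative_eq_intros)
  qed (use False \<open>0 \<le> T\<close> B * in \<open>auto intro!: continuous_intros\<close>)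
  then show ?thesis by simp
qed simp

text \<open>The second difference is the increment over 0 \<le> s \<le> t of f (x + s h + t k) - f
  (x + s h), and the s-derivative of this is in turn an increment of f' h in the direction k. Two
  mean value inequalities therefore compare it with t^2 times \<open>g' x k\<close>.\<close>

lemma second_difference_tendsto:
  fixes f :: "'a::real_normed_vector \<Rightarrow> 'b::real_normed_vector"
  assumes f: "\<And>x. (f has_derivative f' x) (at x)"
    and g: "\<And>x. ((\<lambda>x. f' x h) has_derivative g' x) (at x)"
    and cont: "isCont (\<lambda>x. g' x k) x"
  shows "((\<lambda>t. (f (x + t *\<^sub>R h + t *\<^sub>R k) - f (x + t *\<^sub>R h) - f (x + t *\<^sub>R k) + f x) /\<^sub>R t\<^sup>2)
    \<longlongrightarrow> g' x k) (at_right 0)"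
proof (rule tendstoI)
  fix e :: real assume "0 < e"
  then have "0 < e / 2" by simp
  with cont obtain d where "0 < d" and d: "\<And>y. dist y x < d \<Longrightarrow> dist (g' y k) (g' x k) < e / 2"
    unfolding continuous_at_eps_delta by blast
  \<comment> \<open>For 0 \<le> s, r \<le> t < \<delta> the point x + s h + r k stays within
    \<open>d\<close> of \<open>x\<close>. The added 1 keeps the denominator positive when h = k =
    0.\<close>
  define \<delta> where "\<delta> = d / (norm h + norm k + 1)"
  have pos: "0 < norm h + norm k + 1"
    by (meson add_nonneg_nonneg add_nonneg_pos norm_ge_zero zero_less_one)
  have "0 < \<delta>"
    using \<open>0 < d\<close> pos by (simp add: \<delta>_def)
  have "dist ((f (x + t *\<^sub>R h + t *\<^sub>R k) - f (x + t *\<^sub>R h) - f (x + t *\<^sub>R k) + f x) /\<^sub>R t\<^sup>2) (g' x k) < e"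
    if t: "0 < t" "t < \<delta>" for t
  proof -
    have near: "norm (g' (x + s *\<^sub>R h + r *\<^sub>R k) k - g' x k) \<le> e / 2"
      if "0 \<le> s" "s \<le> t" "0 \<le> r" "r \<le> t" for s r
    proof -
      have "norm (s *\<^sub>R h + r *\<^sub>R k) \<le> s * norm h + r * norm k"
        using that by (metis abs_of_nonneg norm_scaleR norm_triangle_ineq)
      also have "\<dots> \<le> t * norm h + t * norm k"
        using that by (intro add_mono mult_right_mono) auto
      also have "\<dots> \<le> t * (norm h + norm k + 1)"
        using t by (simp add: algebra_simps)
      also have "\<dots> < d"
        using t pos by (simp add: \<delta>_def pos_less_divide_eq)
      finally have "dist (x + s *\<^sub>R h + r *\<^sub>R k) x < d"
        by (simp add: dist_norm add.assoc)
      from d[OF this] show ?thesis by (simp add: dist_norm)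
    qed
    \<comment> \<open>First mean value inequality, in the variable r: once the linear term is
      subtracted, the derivative has norm at most e / 2 by \<open>near\<close>.\<close>
    have inner: "norm (f' (x + s *\<^sub>R h + t *\<^sub>R k) h - f' (x + s *\<^sub>R h) h - t *\<^sub>R g' x k) \<le> e / 2 * t"
      if s: "0 \<le> s" "s \<le> t" for s
    proof -
      define m where m: "m = g' x k"
      have V: "((\<lambda>r. f' (x + s *\<^sub>R h + r *\<^sub>R k) h - r *\<^sub>R m) has_vector_derivative
          g' (x + s *\<^sub>R h + r *\<^sub>R k) k - m) (at r)" for r
      proof -
        have "((\<lambda>r. f' (x + s *\<^sub>R h + r *\<^sub>R k) h) has_vector_derivative
          g' (x + s *\<^sub>R h + r *\<^sub>R k) k) (at r)"
          unfolding has_vector_derivative_def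
          by (rule has_derivative_eq_rhs, rule has_derivative_compose[OF _ g])
            (auto intro!: derivative_eq_intros simp: linear_cmul[OF has_derivative_linear[OF g]])
        then show ?thesis
          by (auto intro!: derivative_eq_intros)
      qed
      have "norm ((f' (x + s *\<^sub>R h + t *\<^sub>R k) h - t *\<^sub>R m) - (f' (x + s *\<^sub>R h + 0 *\<^sub>R k) h - 0 *\<^sub>R m))
          \<le> e / 2 * t - e / 2 * 0"
      proof (rule differentiable_bound_general)
        show "continuous_on {0..t} (\<lambda>r. f' (x + s *\<^sub>R h + r *\<^sub>R k) h - r *\<^sub>R m)"
          using V by (meson continuous_at_imp_continuous_on has_vector_derivative_continuous)
        show "((\<lambda>r. e / 2 * r) has_vector_derivative e / 2) (at r)" for r
          by (auto intro!: derivative_eq_intros)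
      qed (use V near[OF s] t m in \<open>auto intro!: continuous_intros\<close>)
      then show ?thesis by (simp add: m algebra_simps)
    qed
    \<comment> \<open>Second mean value inequality, in s: the increment of this function from 0 to t
      is the second difference minus t^2 times \<open>g' x k\<close>, and \<open>inner\<close>
      bounds its derivative.\<close>
    have V: "((\<lambda>s. f (x + s *\<^sub>R h + t *\<^sub>R k) - f (x + s *\<^sub>R h) - (s * t) *\<^sub>R g' x k) has_vector_derivative
        f' (x + s *\<^sub>R h + t *\<^sub>R k) h - f' (x + s *\<^sub>R h) h - t *\<^sub>R g' x k) (at s)" for s
    proof -
      have "((\<lambda>s. f (x + s *\<^sub>R h + c)) has_vector_derivative f' (x + s *\<^sub>R h + c) h) (at s)" for c
        unfolding has_vector_derivative_def
        by (rule has_derivative_eq_rhs, rule has_derivative_compose[OF _ f])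
          (auto intro!: derivative_eq_intros simp: linear_cmul[OF has_derivative_linear[OF f]])
      from this[of "t *\<^sub>R k"] this[of 0] show ?thesis
        by (auto intro!: derivative_eq_intros)
    qed
    have "norm ((f (x + t *\<^sub>R h + t *\<^sub>R k) - f (x + t *\<^sub>R h) - (t * t) *\<^sub>R g' x k)
          - (f (x + 0 *\<^sub>R h + t *\<^sub>R k) - f (x + 0 *\<^sub>R h) - (0 * t) *\<^sub>R g' x k))
        \<le> e / 2 * t * t - e / 2 * t * 0"
    proof (rule differentiable_bound_general)
      show "continuous_on {0..t} (\<lambda>s. f (x + s *\<^sub>R h + t *\<^sub>R k) - f (x + s *\<^sub>R h) - (s * t) *\<^sub>R g' x k)"
        using V by (meson continuous_at_imp_continuous_on has_vector_derivative_continuous)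
      show "((\<lambda>r. e / 2 * t * r) has_vector_derivative e / 2 * t) (at r)" for r
        by (auto intro!: derivative_eq_intros)
    qed (use V inner t in \<open>auto intro!: continuous_intros\<close>)
    then have *: "norm (f (x + t *\<^sub>R h + t *\<^sub>R k) - f (x + t *\<^sub>R h) - f (x + t *\<^sub>R k) + f x - t\<^sup>2 *\<^sub>R g' x k)
        \<le> e / 2 * t\<^sup>2"
      by (simp add: algebra_simps power2_eq_square)
    let ?D = "f (x + t *\<^sub>R h + t *\<^sub>R k) - f (x + t *\<^sub>R h) - f (x + t *\<^sub>R k) + f x"
    have "?D /\<^sub>R t\<^sup>2 - g' x k = (?D - t\<^sup>2 *\<^sub>R g' x k) /\<^sub>R t\<^sup>2"
      using t by (simp add: scaleR_diff_right)
    then have "dist (?D /\<^sub>R t\<^sup>2) (g' x k) = norm (?D - t\<^sup>2 *\<^sub>R g' x k) / t\<^sup>2"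
      by (simp add: dist_norm divide_inverse_commute)
    also have "\<dots> \<le> e / 2"
      using * t by (simp add: pos_divide_le_eq)
    finally show ?thesis
      using \<open>0 < e\<close> by linarith
  qed
  then show "\<forall>\<^sub>F t in at_right 0.
      dist ((f (x + t *\<^sub>R h + t *\<^sub>R k) - f (x + t *\<^sub>R h) - f (x + t *\<^sub>R k) + f x) /\<^sub>R t\<^sup>2) (g' x k) < e"
    using \<open>0 < \<delta>\<close> by (auto simp: eventually_at_right_field)
qed

text \<open>The second difference is symmetric in \<open>h\<close> and \<open>k\<close>, so both
  mixed derivatives are limits of the same expression.\<close>

lemma mixed_derivatives_eq:
  fixes f :: "'a::real_normed_vector \<Rightarrow> 'b::real_normed_vector"
  assumes f: "\<And>x. (f has_derivative f' x) (at x)"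
    and g: "\<And>x. ((\<lambda>x. f' x h) has_derivative g' x) (at x)"
    and k: "\<And>x. ((\<lambda>x. f' x k) has_derivative k' x) (at x)"
    and "isCont (\<lambda>x. g' x k) x" "isCont (\<lambda>x. k' x h) x"
  shows "g' x k = k' x h"
proof (rule tendsto_unique)
  show "((\<lambda>t. (f (x + t *\<^sub>R h + t *\<^sub>R k) - f (x + t *\<^sub>R h) - f (x + t *\<^sub>R k) + f x) /\<^sub>R t\<^sup>2)
      \<longlongrightarrow> g' x k) (at_right (0::real))"
    by (rule second_difference_tendsto) fact+
  have "((\<lambda>t. (f (x + t *\<^sub>R k + t *\<^sub>R h) - f (x + t *\<^sub>R k) - f (x + t *\<^sub>R h) + f x) /\<^sub>R t\<^sup>2)
      \<longlongrightarrow> k' x h) (at_right (0::real))"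
    by (rule second_difference_tendsto) fact+
  then show "((\<lambda>t. (f (x + t *\<^sub>R h + t *\<^sub>R k) - f (x + t *\<^sub>R h) - f (x + t *\<^sub>R k) + f x) /\<^sub>R t\<^sup>2)
      \<longlongrightarrow> k' x h) (at_right (0::real))"
    by (simp add: algebra_simps)
qed simp

text \<open>By translation invariance every difference quotient in direction \<open>h\<close> has
  integral 0, and dominated convergence carries this over to the derivative. Integration by parts is
  used in this form, with \<open>f\<close> a component of a vector field.\<close>

lemma integral_derivative_eq_0:
  fixes f :: "'a::euclidean_space \<Rightarrow> 'b::euclidean_space"
  assumes f: "\<And>x. (f has_derivative f' x) (at x)"
    and cont: "continuous_on UNIV (\<lambda>x. f' x h)"
    and supp: "bounded {x. f x \<noteq> 0}"
  shows "(\<integral>x. f' x h \<partial>lborel) = 0"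
proof -
  obtain R where R: "\<And>x. f x \<noteq> 0 \<Longrightarrow> norm x \<le> R"
    using supp by (auto simp: bounded_iff)
  \<comment> \<open>With steps of at most \<open>h\<close> the difference quotients vanish outside
    the ball of radius R + |h|, and the segments that start in that ball stay in
    \<open>?K\<close>.\<close>
  let ?K = "cball 0 (R + 2 * norm h)"
  obtain B0 where B0: "\<And>x. x \<in> ?K \<Longrightarrow> norm (f' x h) \<le> B0"
    using compact_imp_bounded[OF compact_continuous_image[OF continuous_on_subset[OF cont subset_UNIV] compact_cball[of 0 "R + 2 * norm h"]]]
    unfolding bounded_iff by blast
  \<comment> \<open>For negative \<open>R\<close> the ball may be empty, which leaves
    \<open>B0\<close> unconstrained; the maximum makes the bound nonnegative.\<close>
  define B where "B = max B0 0"
  have B: "norm (f' x h) \<le> B" if "x \<in> ?K" for x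
    using B0[OF that] by (simp add: B_def)
  have "0 \<le> B" by (simp add: B_def)
  have contf: "continuous_on UNIV f"
    using f by (meson continuous_at_imp_continuous_on has_derivative_continuous)
  have fm[measurable]: "f \<in> borel_measurable borel"
    using contf by (rule borel_measurable_continuous_onI)
  have fint: "integrable lborel f"
  proof -
    have "integrable lborel (\<lambda>x. indicator (cball 0 R) x *\<^sub>R f x)"
      by (rule borel_integrable_compact) (auto intro: continuous_on_subset[OF contf])
    moreover have "indicator (cball 0 R) x *\<^sub>R f x = f x" for x
      using R[of x] by (auto simp: indicator_def)
    ultimately show ?thesis by simp
  qed
  define s where "s n x = real (Suc n) *\<^sub>R (f (x + (1 / real (Suc n)) *\<^sub>R h) - f x)" for n x
  have shift: "integrable lborel (\<lambda>x. f (x + c)) \<and> (\<integral>x. f (x + c) \<partial>lborel) = (\<integral>x. f x \<partial>lborel)" for c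
  proof -
    have "integrable (distr lborel borel ((+) c)) f"
      using fint by (simp add: lborel_distr_plus)
    moreover have "(\<integral>x. f x \<partial>distr lborel borel ((+) c)) = (\<integral>x. f x \<partial>lborel)"
      by (simp add: lborel_distr_plus)
    ultimately show ?thesis
      by (simp add: integrable_distr_eq integral_distr add.commute)
  qed
  have s0: "(\<integral>x. s n x \<partial>lborel) = 0" for n
    using shift[of "(1 / real (Suc n)) *\<^sub>R h"] fint unfolding s_def by simp
  have lim: "(\<lambda>n. s n x) \<longlonglongrightarrow> f' x h" for x
  proof -
    have "((\<lambda>t. f (x + t *\<^sub>R h)) has_vector_derivative f' x h) (at 0)"
      unfolding has_vector_derivative_def
      by (rule has_derivative_eq_rhs, rule has_derivative_compose[OF _ f])
        (auto intro!: derivative_eq_intros simp: linear_cmul[OF has_derivative_linear[OF f]])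
    then have "((\<lambda>t. norm (f (x + t *\<^sub>R h) - f x - t *\<^sub>R f' x h) / norm t) \<longlongrightarrow> 0) (at 0)"
      by (simp add: has_vector_derivative_def has_derivative_at)
    moreover have "\<forall>\<^sub>F t in at 0. norm (f (x + t *\<^sub>R h) - f x - t *\<^sub>R f' x h) / norm t
        = norm ((f (x + t *\<^sub>R h) - f x) /\<^sub>R t - f' x h)"
      unfolding eventually_at_filter
    proof (intro always_eventually allI impI)
      fix t :: real assume "t \<noteq> 0"
      then have "(f (x + t *\<^sub>R h) - f x) /\<^sub>R t - f' x h = (f (x + t *\<^sub>R h) - f x - t *\<^sub>R f' x h) /\<^sub>R t"
        by (simp add: scaleR_diff_right)
      then show "norm (f (x + t *\<^sub>R h) - f x - t *\<^sub>R f' x h) / norm t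
          = norm ((f (x + t *\<^sub>R h) - f x) /\<^sub>R t - f' x h)"
        by (simp add: divide_inverse_commute)
    qed
    ultimately have "((\<lambda>t. norm ((f (x + t *\<^sub>R h) - f x) /\<^sub>R t - f' x h)) \<longlongrightarrow> 0) (at 0)"
      by (rule Lim_transform_eventually)
    then have "((\<lambda>t. (f (x + t *\<^sub>R h) - f x) /\<^sub>R t) \<longlongrightarrow> f' x h) (at 0)"
      unfolding tendsto_norm_zero_iff by (rule LIM_zero_cancel)
    moreover have "filterlim (\<lambda>n. 1 / real (Suc n)) (at 0) sequentially"
      using LIMSEQ_Suc[OF lim_1_over_n] by (auto simp: filterlim_at)
    ultimately have "(\<lambda>n. (f (x + (1 / real (Suc n)) *\<^sub>R h) - f x) /\<^sub>R (1 / real (Suc n))) \<longlonglongrightarrow> f' x h"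
      by (rule filterlim_compose)
    then show ?thesis by (simp add: s_def)
  qed
  have bound: "norm (s n x) \<le> B * indicator (cball 0 (R + norm h)) x" for n x
  proof (cases "x \<in> cball 0 (R + norm h)")
    case True
    have small: "t * norm h \<le> norm h" if "0 \<le> t" "t \<le> 1" for t
      using that by (simp add: mult_left_le_one_le)
    have "norm (f (x + (1 / real (Suc n)) *\<^sub>R h) - f x) \<le> B * (1 / real (Suc n))"
    proof (rule directional_derivative_bound[OF f])
      fix t assume t: "0 \<le> t" "t \<le> 1 / real (Suc n)"
      moreover have "1 / real (Suc n) \<le> 1" by simp
      ultimately have "t * norm h \<le> norm h" by (intro small) linarith+
      then have "norm (x + t *\<^sub>R h) \<le> R + 2 * norm h"
        using norm_triangle_ineq[of x "t *\<^sub>R h"] True t by simp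
      then show "norm (f' (x + t *\<^sub>R h) h) \<le> B" by (intro B) simp
    qed simp
    then show ?thesis
      using True unfolding s_def norm_scaleR by (simp add: field_simps)
  next
    case False
    then have x: "norm x > R + norm h" by simp
    have "norm ((1 / real (Suc n)) *\<^sub>R h) \<le> norm h"
      by (simp add: divide_le_eq mult_left_le mult_left_le_one_le mult_le_cancel_left1)
    then have "norm (x + (1 / real (Suc n)) *\<^sub>R h) > R"
      using x norm_diff_ineq[of x "(1 / real (Suc n)) *\<^sub>R h"] by linarith
    moreover have "norm x > R"
      using x norm_ge_zero[of h] by linarith
    ultimately have "f x = 0" "f (x + (1 / real (Suc n)) *\<^sub>R h) = 0"
      using R by force+
    then show ?thesis
      using \<open>0 \<le> B\<close> by (simp add: s_def)
  qed
  have "(\<lambda>n. \<integral>x. s n x \<partial>lborel) \<longlonglongrightarrow> (\<integral>x. f' x h \<partial>lborel)"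
  proof (rule integral_dominated_convergence)
    show "(\<lambda>x. f' x h) \<in> borel_measurable lborel"
      using borel_measurable_continuous_onI[OF cont] by simp
    show "s n \<in> borel_measurable lborel" for n
      unfolding s_def by measurable
    show "integrable lborel (\<lambda>x. B * indicator (cball 0 (R + norm h)) x :: real)"
      by (intro integrable_mult_right integrable_real_indicator) (use emeasure_bounded_finite[OF bounded_cball] in auto)
  qed (use lim bound in auto)
  then show ?thesis
    by (simp add: s0 LIMSEQ_const_iff)
qed

subsection \<open>Square integrable functions and Riesz representation\<close>

definition square_integrable :: "'a measure \<Rightarrow> ('a \<Rightarrow> complex) \<Rightarrow> bool" where
  "square_integrable M f \<longleftrightarrow> f \<in> borel_measurable M \<and> integrable M (\<lambda>x. (cmod (f x))\<^sup>2)"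

text \<open>The square is kept so that the quadratic expansions below need no roots. The value is
  the default 0 when the square of the modulus is not integrable. The measure is a parameter because
  the weighted inequality lives on \<open>lborel\<close> and the duality argument on
  \<open>lebesgue\<close>.\<close>

definition sq_norm :: "'a measure \<Rightarrow> ('a \<Rightarrow> complex) \<Rightarrow> real" where
  "sq_norm M f = (\<integral>x. (cmod (f x))\<^sup>2 \<partial>M)"

lemma sq_norm_nonneg [simp]: "0 \<le> sq_norm M f"
  by (simp add: sq_norm_def)

lemma square_integrable_cnj: "square_integrable M f \<Longrightarrow> square_integrable M (\<lambda>x. cnj (f x))"
  using measurable_compose[OF _ borel_measurable_continuous_onI[OF continuous_on_cnj[OF continuous_on_id]], of f M]
  by (simp add: square_integrable_def)

text \<open>The combination a f + g covers sums and multiples at once; linearity is stated in this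
  form throughout.\<close>

lemma square_integrable_add_mult:
  assumes "square_integrable M f" "square_integrable M g"
  shows "square_integrable M (\<lambda>x. a * f x + g x)"
proof -
  have [measurable]: "f \<in> borel_measurable M" "g \<in> borel_measurable M"
    using assms by (auto simp: square_integrable_def)
  have bound: "(cmod (a * f x + g x))\<^sup>2 \<le> 2 * (cmod a)\<^sup>2 * (cmod (f x))\<^sup>2 + 2 * (cmod (g x))\<^sup>2" for x
  proof -
    have "(cmod (a * f x + g x))\<^sup>2 \<le> (cmod (a * f x) + cmod (g x))\<^sup>2"
      by (intro power_mono norm_triangle_ineq) simp
    also have "\<dots> \<le> 2 * (cmod (a * f x))\<^sup>2 + 2 * (cmod (g x))\<^sup>2"
      using sum_squares_bound[of "cmod (a * f x)" "cmod (g x)"] by (simp add: power2_sum)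
    finally show ?thesis by (simp add: norm_mult power_mult_distrib)
  qed
  have "integrable M (\<lambda>x. (cmod (a * f x + g x))\<^sup>2)"
    by (rule Bochner_Integration.integrable_bound
        [of M "\<lambda>x. 2 * (cmod a)\<^sup>2 * (cmod (f x))\<^sup>2 + 2 * (cmod (g x))\<^sup>2"])
      (use assms bound in \<open>auto simp: square_integrable_def\<close>)
  then show ?thesis by (simp add: square_integrable_def)
qed

lemma square_integrable_diff:
  assumes "square_integrable M f" "square_integrable M g"
  shows "square_integrable M (\<lambda>x. f x - g x)"
  using square_integrable_add_mult[OF assms(2,1), of "-1"] by simp

lemma integrable_mult_square_integrable:
  assumes "square_integrable M f" "square_integrable M g"
  shows "integrable M (\<lambda>x. f x * g x)"
proof -
  have [measurable]: "f \<in> borel_measurable M" "g \<in> borel_measurable M"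
    using assms by (auto simp: square_integrable_def)
  have bound: "cmod (f x * g x) \<le> (cmod (f x))\<^sup>2 + (cmod (g x))\<^sup>2" for x
  proof -
    have "2 * (cmod (f x) * cmod (g x)) \<le> (cmod (f x))\<^sup>2 + (cmod (g x))\<^sup>2"
      using sum_squares_bound[of "cmod (f x)" "cmod (g x)"] by (simp add: mult.assoc)
    moreover have "0 \<le> cmod (f x) * cmod (g x)" by simp
    ultimately show ?thesis by (simp only: norm_mult)
  qed
  show ?thesis
    by (rule Bochner_Integration.integrable_bound[of M "\<lambda>x. (cmod (f x))\<^sup>2 + (cmod (g x))\<^sup>2"])
      (use assms bound in \<open>auto simp: square_integrable_def\<close>)
qed

text \<open>The inequality for nonnegative extended integrals is applied to the moduli. The pairing
  is bilinear, without conjugate, as in the distributional equation.\<close>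

lemma integral_Cauchy_Schwarz:
  assumes "square_integrable M f" "square_integrable M g"
  shows "cmod (\<integral>x. f x * g x \<partial>M) \<le> sqrt (sq_norm M f) * sqrt (sq_norm M g)"
proof -
  have [measurable]: "f \<in> borel_measurable M" "g \<in> borel_measurable M"
    using assms by (auto simp: square_integrable_def)
  have "integrable M (\<lambda>x. cmod (f x) * cmod (g x))"
    using integrable_norm[OF integrable_mult_square_integrable[OF assms]] by (simp add: norm_mult)
  then have "(\<integral>\<^sup>+x. ennreal (cmod (f x)) * ennreal (cmod (g x)) \<partial>M)
      = ennreal (\<integral>x. cmod (f x) * cmod (g x) \<partial>M)"
    by (subst nn_integral_eq_integral[symmetric]) (auto simp: ennreal_mult)
  moreover have "(\<integral>\<^sup>+x. (ennreal (cmod (h x)))\<^sup>2 \<partial>M) = ennreal (sq_norm M h)"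
    if "square_integrable M h" for h
    using that unfolding sq_norm_def square_integrable_def
    by (subst nn_integral_eq_integral[symmetric]) (auto simp: ennreal_power)
  ultimately have "(ennreal (\<integral>x. cmod (f x) * cmod (g x) \<partial>M))\<^sup>2
      \<le> ennreal (sq_norm M f) * ennreal (sq_norm M g)"
    using Cauchy_Schwarz_nn_integral[of "\<lambda>x. ennreal (cmod (f x))" M "\<lambda>x. ennreal (cmod (g x))"] assms
    by simp
  then have "(\<integral>x. cmod (f x) * cmod (g x) \<partial>M)\<^sup>2 \<le> sq_norm M f * sq_norm M g"
    by (simp add: ennreal_power flip: ennreal_mult)
  then have "(\<integral>x. cmod (f x) * cmod (g x) \<partial>M) \<le> sqrt (sq_norm M f) * sqrt (sq_norm M g)"
    by (simp add: real_le_rsqrt flip: real_sqrt_mult)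
  moreover have "cmod (\<integral>x. f x * g x \<partial>M) \<le> (\<integral>x. cmod (f x) * cmod (g x) \<partial>M)"
    using integral_norm_bound[of M "\<lambda>x. f x * g x"] by (simp add: norm_mult)
  ultimately show ?thesis by linarith
qed

text \<open>The parameter values 1 and -1 give the triangle inequality and the parallelogram law,
  and a general real \<open>t\<close> gives the first variation in the Riesz theorem.\<close>

lemma sq_norm_add_mult:
  assumes "square_integrable M f" "square_integrable M g"
  shows "sq_norm M (\<lambda>x. of_real t * g x + f x)
    = sq_norm M f + 2 * t * Re (\<integral>x. cnj (f x) * g x \<partial>M) + t\<^sup>2 * sq_norm M g"
proof -
  have int: "integrable M (\<lambda>x. cnj (f x) * g x)"
    by (intro integrable_mult_square_integrable square_integrable_cnj assms)
  have "sq_norm M (\<lambda>x. of_real t * g x + f x)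
      = (\<integral>x. (cmod (f x))\<^sup>2 + 2 * t * Re (cnj (f x) * g x) + t\<^sup>2 * (cmod (g x))\<^sup>2 \<partial>M)"
    unfolding sq_norm_def
    by (intro Bochner_Integration.integral_cong refl)
      (simp only: cmod_power2, simp add: power2_eq_square algebra_simps)
  also have "\<dots> = sq_norm M f + 2 * t * (\<integral>x. Re (cnj (f x) * g x) \<partial>M) + t\<^sup>2 * sq_norm M g"
    using int assms by (simp add: sq_norm_def square_integrable_def del: times_complex.sel)
  also have "(\<integral>x. Re (cnj (f x) * g x) \<partial>M) = Re (\<integral>x. cnj (f x) * g x \<partial>M)"
    using int by (rule integral_Re)
  finally show ?thesis .
qed

lemma sqrt_sq_norm_triangle:
  assumes "square_integrable M f" "square_integrable M g"
  shows "sqrt (sq_norm M (\<lambda>x. f x + g x)) \<le> sqrt (sq_norm M f) + sqrt (sq_norm M g)"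
proof (rule real_le_lsqrt)
  have "Re (\<integral>x. cnj (f x) * g x \<partial>M) \<le> sqrt (sq_norm M (\<lambda>x. cnj (f x))) * sqrt (sq_norm M g)"
    using integral_Cauchy_Schwarz[OF square_integrable_cnj[OF assms(1)] assms(2)]
      complex_Re_le_cmod order_trans by blast
  then show "sq_norm M (\<lambda>x. f x + g x) \<le> (sqrt (sq_norm M f) + sqrt (sq_norm M g))\<^sup>2"
    using sq_norm_add_mult[OF assms, of 1]
    by (simp add: power2_sum sq_norm_def add.commute)
qed simp

text \<open>Solved for the difference, because the midpoint of two members of a minimising sequence
  competes in the same minimisation.\<close>

lemma parallelogram_sq_norm:
  assumes "square_integrable M f" "square_integrable M g"
  shows "sq_norm M (\<lambda>x. f x - g x) = 2 * sq_norm M f + 2 * sq_norm M g - 4 * sq_norm M (\<lambda>x. (f x + g x) / 2)"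
proof -
  have "sq_norm M (\<lambda>x. f x + g x) = 4 * sq_norm M (\<lambda>x. (f x + g x) / 2)"
    by (simp add: sq_norm_def norm_divide power_divide)
  then show ?thesis
    using sq_norm_add_mult[OF assms, of 1] sq_norm_add_mult[OF assms, of "-1"]
    by (simp add: add.commute)
qed

text \<open>The geometric rate makes the sequence converge almost everywhere, not only along a subsequence.\<close>

lemma square_integrable_complete:
  fixes f :: "nat \<Rightarrow> 'a \<Rightarrow> complex"
  assumes f: "\<And>n. square_integrable M (f n)"
    and Cauchy: "\<And>n m. n \<le> m \<Longrightarrow> sq_norm M (\<lambda>x. f m x - f n x) \<le> K / 8 ^ n"
  obtains g where "square_integrable M g" "\<And>n. sq_norm M (\<lambda>x. g x - f n x) \<le> K / 8 ^ n"
proof -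
  have [measurable]: "f n \<in> borel_measurable M" for n
    using f by (simp add: square_integrable_def)
  have "0 \<le> K"
    using Cauchy[of 0 0] by (simp add: sq_norm_def)
  have nn: "(\<integral>\<^sup>+x. ennreal ((cmod (h x))\<^sup>2) \<partial>M) = ennreal (sq_norm M h)" if "square_integrable M h" for h
    using that unfolding sq_norm_def square_integrable_def by (subst nn_integral_eq_integral) auto
  \<comment> \<open>The factor 4^n lies between two requirements: the integrals K / 2^n are still
    summable, and a bound on \<open>d n x\<close> uniform in n makes the increments O(2^-n)
    pointwise.\<close>
  define d where "d n x = 4 ^ n * (cmod (f (Suc n) x - f n x))\<^sup>2" for n x
  have [measurable]: "d n \<in> borel_measurable M" for n
    unfolding d_def by measurable
  have "(\<integral>\<^sup>+x. ennreal (d n x) \<partial>M) \<le> ennreal (K * (1 / 2) ^ n)" for n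
  proof -
    have "(\<integral>\<^sup>+x. ennreal (d n x) \<partial>M)
        = ennreal (4 ^ n) * (\<integral>\<^sup>+x. ennreal ((cmod (f (Suc n) x - f n x))\<^sup>2) \<partial>M)"
      unfolding d_def by (subst nn_integral_cmult[symmetric]) (auto simp: ennreal_mult)
    also have "\<dots> = ennreal (4 ^ n * sq_norm M (\<lambda>x. f (Suc n) x - f n x))"
      by (simp add: nn square_integrable_diff f ennreal_mult)
    also have "\<dots> \<le> ennreal (4 ^ n * (K / 8 ^ n))"
      by (intro ennreal_leI mult_left_mono Cauchy) auto
    also have "4 ^ n * (K / 8 ^ n) = K * (1 / 2) ^ n"
      using power_mult_distrib[of "2::real" 4 n] by (simp add: field_simps)
    finally show ?thesis .
  qed
  then have "(\<integral>\<^sup>+x. (\<Sum>n. ennreal (d n x)) \<partial>M) \<le> (\<Sum>n. ennreal (K * (1 / 2) ^ n))"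
    by (subst nn_integral_suminf) (auto intro!: suminf_le)
  also have "\<dots> < \<infinity>"
    using \<open>0 \<le> K\<close> by (simp add: suminf_ennreal_eq[OF _ sums_mult[OF geometric_sums]])
  finally have "AE x in M. (\<Sum>n. ennreal (d n x)) \<noteq> \<infinity>"
    by (intro nn_integral_PInf_AE) auto
  then have conv: "AE x in M. convergent (\<lambda>n. f n x)"
  proof eventually_elim
    case (elim x)
    then have sm: "summable (\<lambda>n. d n x)"
      by (intro summable_suminf_not_top) (auto simp: d_def)
    define S where "S = (\<Sum>n. d n x)"
    have "cmod (f (Suc n) x - f n x) \<le> sqrt S * (1 / 2) ^ n" for n
    proof -
      have "d n x \<le> S"
        unfolding S_def using sum_le_suminf[OF sm, of "{n}"] by (auto simp: d_def)
      then have "sqrt (d n x) \<le> sqrt S" by simp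
      moreover have "sqrt (d n x) = 2 ^ n * cmod (f (Suc n) x - f n x)"
        unfolding d_def real_sqrt_mult using real_sqrt_power[of 4 n] by simp
      ultimately show ?thesis by (simp add: field_simps)
    qed
    then have "summable (\<lambda>n. f (Suc n) x - f n x)"
      by (rule summable_comparison_test'[of "\<lambda>n. sqrt S * (1 / 2) ^ n" 0, rotated])
        (simp add: summable_mult summable_geometric)
    then have "convergent (\<lambda>n. f n x - f 0 x)"
      using sum_lessThan_telescope[of "\<lambda>n. f n x"] by (simp add: summable_iff_convergent)
    then show ?case by (simp add: convergent_diff_const_right_iff)
  qed
  \<comment> \<open>\<open>lim\<close> has an unspecified value where the sequence diverges; by
    \<open>conv\<close> this happens only on a null set.\<close>
  define g where "g x = lim (\<lambda>n. f n x)" for x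
  have [measurable]: "g \<in> borel_measurable M"
    unfolding g_def by measurable
  have lim: "AE x in M. (\<lambda>n. f n x) \<longlonglongrightarrow> g x"
    using conv by (simp add: g_def convergent_LIMSEQ_iff)
  \<comment> \<open>Fatou's lemma in the index m, with n fixed.\<close>
  have bound: "(\<integral>\<^sup>+x. ennreal ((cmod (g x - f n x))\<^sup>2) \<partial>M) \<le> ennreal (K / 8 ^ n)" for n
  proof -
    have "(\<integral>\<^sup>+x. ennreal ((cmod (g x - f n x))\<^sup>2) \<partial>M)
        = (\<integral>\<^sup>+x. liminf (\<lambda>m. ennreal ((cmod (f m x - f n x))\<^sup>2)) \<partial>M)"
    proof (rule nn_integral_cong_AE, use lim in eventually_elim)
      case (elim x)
      then have "(\<lambda>m. ennreal ((cmod (f m x - f n x))\<^sup>2)) \<longlonglongrightarrow> ennreal ((cmod (g x - f n x))\<^sup>2)"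
        by (intro tendsto_intros)
      then show ?case
        by (metis lim_imp_Liminf sequentially_bot)
    qed
    also have "\<dots> \<le> liminf (\<lambda>m. \<integral>\<^sup>+x. ennreal ((cmod (f m x - f n x))\<^sup>2) \<partial>M)"
      by (rule nn_integral_liminf) auto
    also have "\<dots> \<le> ennreal (K / 8 ^ n)"
    proof (rule Liminf_le[OF sequentially_bot])
      show "\<forall>\<^sub>F m in sequentially. (\<integral>\<^sup>+x. ennreal ((cmod (f m x - f n x))\<^sup>2) \<partial>M) \<le> ennreal (K / 8 ^ n)"
        using eventually_ge_at_top[of n]
        by eventually_elim (simp only: nn[OF square_integrable_diff[OF f f]] ennreal_leI Cauchy)
    qed
    finally show ?thesis .
  qed
  have sq: "square_integrable M (\<lambda>x. g x - f n x)" for n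
  proof -
    have "(\<integral>\<^sup>+x. ennreal ((cmod (g x - f n x))\<^sup>2) \<partial>M) < \<infinity>"
      using le_less_trans[OF bound[of n] ennreal_less_top] by simp
    then show ?thesis
      by (simp add: square_integrable_def integrable_iff_bounded)
  qed
  show thesis
  proof
    show "square_integrable M g"
      using square_integrable_add_mult[OF f[of 0] sq[of 0], of 1] by simp
    show "sq_norm M (\<lambda>x. g x - f n x) \<le> K / 8 ^ n" for n
      using bound[of n] \<open>0 \<le> K\<close> by (simp add: nn[OF sq])
  qed
qed

text \<open>A bounded functional on a subspace is given here by its graph. The representing function is
  the conjugate of the limit of a sequence minimising \<open>\<parallel>f\<parallel>\<^sup>2 - 2 Re c\<close> over the pairs \<open>(f, c)\<close>.\<close>

theorem Riesz_representation_linear_relation: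
  fixes G :: "(('a \<Rightarrow> complex) \<times> complex) set"
  assumes sq: "\<And>f c. (f, c) \<in> G \<Longrightarrow> square_integrable M f"
    and lin: "\<And>a f c g d. (f, c) \<in> G \<Longrightarrow> (g, d) \<in> G \<Longrightarrow> (\<lambda>x. a * f x + g x, a * c + d) \<in> G"
    and bdd: "\<And>f c. (f, c) \<in> G \<Longrightarrow> cmod c \<le> C * sqrt (sq_norm M f)"
    and zero: "(\<lambda>_. 0, 0) \<in> G"
    and "0 \<le> C"
  obtains u where "square_integrable M u" "sqrt (sq_norm M u) \<le> C"
    "\<And>f c. (f, c) \<in> G \<Longrightarrow> (\<integral>x. u x * f x \<partial>M) = c"
proof -
  define J where "J p = sq_norm M (fst p) - 2 * Re (snd p)" for p :: "('a \<Rightarrow> complex) \<times> complex"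
  \<comment> \<open>With N the norm of the first component, N^2 - 2 C N \<ge> - C^2 by completing
    the square.\<close>
  have Jbound: "- C\<^sup>2 \<le> J p" if "p \<in> G" for p
  proof -
    have "Re (snd p) \<le> C * sqrt (sq_norm M (fst p))"
      using bdd[of "fst p" "snd p"] that complex_Re_le_cmod[of "snd p"] by simp
    moreover have "0 \<le> (sqrt (sq_norm M (fst p)) - C)\<^sup>2" by simp
    ultimately show ?thesis
      by (simp add: J_def power2_diff mult.commute)
  qed
  define m where "m = Inf (J ` G)"
  have bddJ: "bdd_below (J ` G)"
    using Jbound by (auto intro!: bdd_belowI[of _ "- C\<^sup>2"])
  have mJ: "m \<le> J p" if "p \<in> G" for p
    unfolding m_def using that bddJ by (intro cInf_lower) auto
  have "\<exists>p\<in>G. J p < m + 1 / 8 ^ n" for n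
  proof -
    have "Inf (J ` G) < m + 1 / 8 ^ n" by (simp add: m_def)
    then show ?thesis
      using zero by (subst (asm) cInf_less_iff[OF _ bddJ]) auto
  qed
  then obtain p where pG: "\<And>n. p n \<in> G" and pJ: "\<And>n. J (p n) < m + 1 / 8 ^ n"
    by metis
  define f where "f n = fst (p n)" for n
  define c where "c n = snd (p n)" for n
  have fc: "(f n, c n) \<in> G" for n
    using pG by (simp add: f_def c_def)
  have fsq: "square_integrable M (f n)" for n
    using fc sq by blast
  have "sq_norm M (\<lambda>x. f k x - f n x) \<le> 4 / 8 ^ n" if "n \<le> k" for n k
  proof -
    \<comment> \<open>The midpoint of \<open>p k\<close> and \<open>p n\<close> lies in
      \<open>G\<close>, so its \<open>J\<close> is at least \<open>m\<close>. By the parallelogram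
      law the squared distance is then at most 2 / 8^k + 2 / 8^n.\<close>
    have "(\<lambda>x. 1 / 2 * f k x + (1 / 2 * f n x + 0), 1 / 2 * c k + (1 / 2 * c n + 0)) \<in> G"
      by (intro lin fc zero)
    then have "m \<le> sq_norm M (\<lambda>x. (f k x + f n x) / 2) - Re (c k) - Re (c n)"
      using mJ by (force simp: J_def add_divide_distrib)
    moreover have "sq_norm M (f i) - 2 * Re (c i) < m + 1 / 8 ^ i" for i
      using pJ[of i] by (simp add: J_def f_def c_def)
    from this[of k] this[of n]
    have "sq_norm M (f k) - 2 * Re (c k) < m + 1 / 8 ^ k" "sq_norm M (f n) - 2 * Re (c n) < m + 1 / 8 ^ n" .
    moreover have "(1::real) / 8 ^ k \<le> 1 / 8 ^ n"
      using that by (intro divide_left_mono power_increasing) auto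
    moreover note parallelogram_sq_norm[OF fsq[of k] fsq[of n]]
    ultimately show ?thesis by argo
  qed
  then obtain g where g: "square_integrable M g"
    and gf: "\<And>n. sq_norm M (\<lambda>x. g x - f n x) \<le> 4 / 8 ^ n"
    using square_integrable_complete[of M f 4] fsq by metis
  have lim0: "(\<lambda>n. K * sqrt (1 / 8 ^ n)) \<longlonglongrightarrow> 0" for K :: real
  proof -
    have "(\<lambda>n. K * sqrt ((1 / 8) ^ n)) \<longlonglongrightarrow> K * sqrt 0"
      by (intro tendsto_intros) auto
    then show ?thesis by (simp add: power_divide)
  qed
  have conv: "(\<lambda>n. \<integral>x. cnj (f n x) * h x \<partial>M) \<longlonglongrightarrow> (\<integral>x. cnj (g x) * h x \<partial>M)"
    if h: "square_integrable M h" for h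
  proof (rule LIM_zero_cancel, rule Lim_null_comparison)
    show "\<forall>\<^sub>F n in sequentially. norm ((\<integral>x. cnj (f n x) * h x \<partial>M) - (\<integral>x. cnj (g x) * h x \<partial>M))
        \<le> 2 * sqrt (sq_norm M h) * sqrt (1 / 8 ^ n)"
    proof (intro always_eventually allI)
      fix n
      have "(\<integral>x. cnj (g x - f n x) * h x \<partial>M)
          = (\<integral>x. cnj (g x) * h x \<partial>M) - (\<integral>x. cnj (f n x) * h x \<partial>M)"
        unfolding complex_cnj_diff left_diff_distrib
        by (intro Bochner_Integration.integral_diff integrable_mult_square_integrable square_integrable_cnj g fsq h)
      then have "norm ((\<integral>x. cnj (f n x) * h x \<partial>M) - (\<integral>x. cnj (g x) * h x \<partial>M))
          = norm (\<integral>x. cnj (g x - f n x) * h x \<partial>M)"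
        by (simp add: norm_minus_commute)
      also have "\<dots> \<le> sqrt (sq_norm M (\<lambda>x. cnj (g x - f n x))) * sqrt (sq_norm M h)"
        by (intro integral_Cauchy_Schwarz square_integrable_cnj square_integrable_diff g fsq h)
      also have "sq_norm M (\<lambda>x. cnj (g x - f n x)) = sq_norm M (\<lambda>x. g x - f n x)"
        unfolding sq_norm_def complex_mod_cnj ..
      also have "sqrt (sq_norm M (\<lambda>x. g x - f n x)) * sqrt (sq_norm M h) \<le> sqrt (4 / 8 ^ n) * sqrt (sq_norm M h)"
        by (intro mult_right_mono) (auto simp: gf)
      finally show "norm ((\<integral>x. cnj (f n x) * h x \<partial>M) - (\<integral>x. cnj (g x) * h x \<partial>M))
        \<le> 2 * sqrt (sq_norm M h) * sqrt (1 / 8 ^ n)"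
        by (simp add: real_sqrt_divide mult.commute)
    qed
  qed (rule lim0)
  \<comment> \<open>First variation: moving \<open>p n\<close> by t (h, d) changes \<open>J\<close>
    by 2 t \<open>r n\<close> + t^2 |h|^2 and cannot go below \<open>m\<close>, so the derivative at
    the almost minimal \<open>p n\<close> is small.\<close>
  have Re_eq: "Re (\<integral>x. cnj (g x) * h x \<partial>M) = Re d" if hd: "(h, d) \<in> G" for h d
  proof -
    define r where "r n = Re (\<integral>x. cnj (f n x) * h x \<partial>M) - Re d" for n
    define q where "q = sq_norm M h + 1"
    have h: "square_integrable M h" using sq hd by blast
    have "(\<lambda>n. r n) \<longlonglongrightarrow> 0"
    proof (rule Lim_null_comparison)
      show "\<forall>\<^sub>F n in sequentially. norm (r n) \<le> sqrt q * sqrt (1 / 8 ^ n)"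
      proof (intro always_eventually allI)
        fix n
        \<comment> \<open>This \<open>t\<close> minimises 2 t \<open>r n\<close> + t^2
          \<open>q\<close>. The 1 added in \<open>q\<close> excludes a zero denominator when h
          vanishes almost everywhere.\<close>
        define t where "t = - (r n / q)"
        have "0 < q" by (simp add: q_def add_nonneg_pos)
        have "m \<le> J (\<lambda>x. of_real t * h x + f n x, of_real t * d + c n)"
          by (intro mJ lin hd fc)
        also have "\<dots> = J (p n) + 2 * t * r n + t\<^sup>2 * sq_norm M h"
          using sq_norm_add_mult[OF fsq[of n] h, of t]
          by (simp add: J_def r_def flip: f_def c_def) (simp add: algebra_simps)
        also have "\<dots> \<le> J (p n) + 2 * t * r n + t\<^sup>2 * q"
          by (simp add: q_def algebra_simps)
        also have "\<dots> = J (p n) - (r n)\<^sup>2 / q"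
          using \<open>0 < q\<close> by (simp add: t_def field_simps power2_eq_square)
        finally have "(r n)\<^sup>2 / q \<le> 1 / 8 ^ n"
          using pJ[of n] by linarith
        then have "(r n)\<^sup>2 \<le> q * (1 / 8 ^ n)"
          using \<open>0 < q\<close> by (simp add: pos_divide_le_eq mult.commute)
        then have "\<bar>r n\<bar> \<le> sqrt (q * (1 / 8 ^ n))"
          by (metis real_sqrt_abs real_sqrt_le_iff)
        then show "norm (r n) \<le> sqrt q * sqrt (1 / 8 ^ n)"
          by (simp only: real_sqrt_mult real_norm_def)
      qed
    qed (rule lim0)
    moreover have "(\<lambda>n. r n) \<longlonglongrightarrow> Re (\<integral>x. cnj (g x) * h x \<partial>M) - Re d"
      unfolding r_def by (intro tendsto_intros conv h)
    ultimately show ?thesis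
      using LIMSEQ_unique by fastforce
  qed
  have eq: "(\<integral>x. cnj (g x) * h x \<partial>M) = d" if hd: "(h, d) \<in> G" for h d
  proof (rule complex_eqI)
    \<comment> \<open>Complex linearity of \<open>G\<close> yields the imaginary part from the real
      part of the pair multiplied by \<i>.\<close>
    have "(\<lambda>x. \<i> * h x + 0, \<i> * d + 0) \<in> G"
      by (intro lin hd zero)
    from Re_eq[OF this] have "Re (\<integral>x. \<i> * (cnj (g x) * h x) \<partial>M) = Re (\<i> * d)"
      by (simp add: mult.left_commute)
    then show "Im (\<integral>x. cnj (g x) * h x \<partial>M) = Im d" by simp
  qed (use Re_eq hd in blast)
  \<comment> \<open>The limit \<open>g\<close> need not be a first component of a pair in
    \<open>G\<close>, so the bound is applied to \<open>f n\<close>: there |\<open>c n\<close>|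
    tends to |g|^2 and is at most C |\<open>f n\<close>|, whence |g|^2 \<le> C |g|.\<close>
  have "sqrt (sq_norm M g) \<le> C"
  proof -
    have *: "(\<integral>x. cnj (g x) * f n x \<partial>M) = c n" for n
      by (rule eq[OF fc])
    have "(\<lambda>n. \<integral>x. cnj (f n x) * g x \<partial>M) \<longlonglongrightarrow> (\<integral>x. cnj (g x) * g x \<partial>M)"
      by (rule conv[OF g])
    moreover have "(\<integral>x. cnj (g x) * g x \<partial>M) = of_real (sq_norm M g)"
    proof -
      have "cnj (g x) * g x = of_real ((cmod (g x))\<^sup>2)" for x
        by (simp add: complex_norm_square mult.commute del: of_real_power)
      then show ?thesis by (simp only: sq_norm_def integral_complex_of_real)
    qed
    moreover have "(\<integral>x. cnj (f n x) * g x \<partial>M) = cnj (c n)" for n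
      using Bochner_Integration.integral_cnj[of M "\<lambda>x. cnj (g x) * f n x"] * by (simp add: mult.commute)
    ultimately have "(\<lambda>n. cnj (c n)) \<longlonglongrightarrow> of_real (sq_norm M g)" by simp
    from tendsto_norm[OF this] have 1: "(\<lambda>n. cmod (c n)) \<longlonglongrightarrow> sq_norm M g" by simp
    have 2: "cmod (c n) \<le> C * (sqrt (sq_norm M g) + 2 * sqrt (1 / 8 ^ n))" for n
    proof -
      have "(\<lambda>x. f n x - g x) = (\<lambda>x. - (g x - f n x))" by simp
      then have "sq_norm M (\<lambda>x. f n x - g x) \<le> 4 / 8 ^ n"
        using gf[of n] by (simp add: sq_norm_def norm_minus_commute)
      then have "sqrt (sq_norm M (\<lambda>x. f n x - g x)) \<le> sqrt (4 * (1 / 8 ^ n))" by simp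
      then have "sqrt (sq_norm M (\<lambda>x. f n x - g x)) \<le> 2 * sqrt (1 / 8 ^ n)"
        by (simp only: real_sqrt_mult real_sqrt_four)
      moreover have "sqrt (sq_norm M (f n)) \<le> sqrt (sq_norm M g) + sqrt (sq_norm M (\<lambda>x. f n x - g x))"
        using sqrt_sq_norm_triangle[OF g square_integrable_diff[OF fsq[of n] g]] by simp
      ultimately have "sqrt (sq_norm M (f n)) \<le> sqrt (sq_norm M g) + 2 * sqrt (1 / 8 ^ n)"
        by linarith
      then show ?thesis
        using bdd[OF fc[of n]] \<open>0 \<le> C\<close> mult_left_mono order_trans by blast
    qed
    have "(\<lambda>n. C * (sqrt (sq_norm M g) + 2 * sqrt (1 / 8 ^ n))) \<longlonglongrightarrow> C * (sqrt (sq_norm M g) + 0)"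
      by (intro tendsto_intros lim0)
    with 1 2 have "sq_norm M g \<le> C * sqrt (sq_norm M g)"
      by (intro LIMSEQ_le[OF 1]) auto
    then have *: "sqrt (sq_norm M g) * sqrt (sq_norm M g) \<le> C * sqrt (sq_norm M g)" by simp
    show ?thesis
    proof (cases "sq_norm M g = 0")
      case False
      then have "0 < sqrt (sq_norm M g)" by (simp add: less_le)
      then show ?thesis by (rule mult_right_le_imp_le[OF *])
    qed (simp add: \<open>0 \<le> C\<close>)
  qed
  moreover have "sq_norm M (\<lambda>x. cnj (g x)) = sq_norm M g"
    unfolding sq_norm_def complex_mod_cnj ..
  ultimately show thesis
    using that[OF square_integrable_cnj[OF g]] eq by simp
qed

subsection \<open>Test functions\<close>

text \<open>Real linearity expands the derivative in the basis 1, \<i>. The explicit form can be fed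
  to the product rule.\<close>

lemma has_derivative_partials:
  assumes "f differentiable at z"
  shows "(f has_derivative (\<lambda>h. Re h *\<^sub>R partial_x f z + Im h *\<^sub>R partial_y f z)) (at z)"
proof -
  let ?D = "frechet_derivative f (at z)"
  have D: "(f has_derivative ?D) (at z)"
    using assms by (simp add: frechet_derivative_works)
  then have "linear ?D" by (rule has_derivative_linear)
  have "?D h = Re h *\<^sub>R ?D 1 + Im h *\<^sub>R ?D \<i>" for h
  proof -
    have "?D (Re h *\<^sub>R 1 + Im h *\<^sub>R \<i>) = Re h *\<^sub>R ?D 1 + Im h *\<^sub>R ?D \<i>"
      by (simp only: linear_add[OF \<open>linear ?D\<close>] linear_cmul[OF \<open>linear ?D\<close>])
    moreover have "Re h *\<^sub>R 1 + Im h *\<^sub>R \<i> = h"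
      by (simp add: complex_eq_iff)
    ultimately show ?thesis by simp
  qed
  then have "?D = (\<lambda>h. Re h *\<^sub>R partial_x f z + Im h *\<^sub>R partial_y f z)"
    unfolding partial_x_def partial_y_def by (rule ext)
  with D show ?thesis by simp
qed

lemma partials_add_mult:
  assumes "f differentiable at z" "g differentiable at z"
  shows "partial_x (\<lambda>z. c * f z + g z) z = c * partial_x f z + partial_x g z"
    "partial_y (\<lambda>z. c * f z + g z) z = c * partial_y f z + partial_y g z"
proof -
  have "((\<lambda>z. c * f z + g z) has_derivative
      (\<lambda>h. c * frechet_derivative f (at z) h + frechet_derivative g (at z) h)) (at z)"
    using assms by (auto intro!: derivative_eq_intros simp: frechet_derivative_works)
  from frechet_derivative_at[OF this, symmetric]
  show "partial_x (\<lambda>z. c * f z + g z) z = c * partial_x f z + partial_x g z"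
    "partial_y (\<lambda>z. c * f z + g z) z = c * partial_y f z + partial_y g z"
    by (simp_all add: partial_x_def partial_y_def)
qed

lemma Ck_add_mult: "Ck k f \<Longrightarrow> Ck k g \<Longrightarrow> Ck k (\<lambda>z. c * f z + g z)"
proof (induction k arbitrary: f g)
  case 0
  then show ?case by (auto intro!: continuous_intros)
next
  case (Suc k)
  then have d: "f differentiable at z" "g differentiable at z" for z by auto
  have "partial_x (\<lambda>z. c * f z + g z) = (\<lambda>z. c * partial_x f z + partial_x g z)"
    "partial_y (\<lambda>z. c * f z + g z) = (\<lambda>z. c * partial_y f z + partial_y g z)"
    using partials_add_mult[OF d] by auto
  with Suc d show ?case by (auto intro!: derivative_intros)
qed

lemma test_functionD:
  assumes "\<phi> \<in> test_functions"
  shows "\<phi> differentiable at z" "continuous_on UNIV \<phi>"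
    "partial_x \<phi> differentiable at z" "continuous_on UNIV (partial_x \<phi>)"
    "partial_y \<phi> differentiable at z" "continuous_on UNIV (partial_y \<phi>)"
    "continuous_on UNIV (partial_y (partial_x \<phi>))" "continuous_on UNIV (partial_x (partial_y \<phi>))"
proof -
  have "Ck k \<phi>" for k using assms by (simp add: test_functions_def)
  from this[of 0] this[of 1] this[of 2]
  show "\<phi> differentiable at z" "continuous_on UNIV \<phi>"
    "partial_x \<phi> differentiable at z" "continuous_on UNIV (partial_x \<phi>)"
    "partial_y \<phi> differentiable at z" "continuous_on UNIV (partial_y \<phi>)"
    "continuous_on UNIV (partial_y (partial_x \<phi>))" "continuous_on UNIV (partial_x (partial_y \<phi>))"
    by (simp_all add: numeral_2_eq_2)
qed

text \<open>Off the closed support \<phi> vanishes on an open set, so its derivatives vanish there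
  too.\<close>

lemma test_function_support:
  assumes "\<phi> \<in> test_functions"
  obtains K where "compact K" "\<And>z. z \<notin> K \<Longrightarrow> \<phi> z = 0 \<and> partial_x \<phi> z = 0 \<and> partial_y \<phi> z = 0"
proof -
  define K where "K = closure {z. \<phi> z \<noteq> 0}"
  have "compact K" using assms by (simp add: test_functions_def K_def)
  have zero: "\<phi> z = 0" if "z \<in> - K" for z
    using that closure_subset[of "{z. \<phi> z \<noteq> 0}"] unfolding K_def by auto
  have "\<phi> z = 0 \<and> partial_x \<phi> z = 0 \<and> partial_y \<phi> z = 0" if z: "z \<notin> K" for z
  proof -
    have "frechet_derivative (\<lambda>_. 0) (at z) = frechet_derivative \<phi> (at z)"
    proof (rule frechet_derivative_transform_within_open)
      show "open (- K)" using \<open>compact K\<close> by (simp add: compact_imp_closed open_Compl)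
    qed (use z zero in auto)
    then have "frechet_derivative \<phi> (at z) = (\<lambda>_. 0)" by simp
    then show ?thesis
      using zero z by (simp add: partial_x_def partial_y_def)
  qed
  with \<open>compact K\<close> show thesis by (rule that)
qed

lemma test_functions_add_mult:
  assumes "f \<in> test_functions" "g \<in> test_functions"
  shows "(\<lambda>z. c * f z + g z) \<in> test_functions"
proof -
  have "{z. c * f z + g z \<noteq> 0} \<subseteq> closure {z. f z \<noteq> 0} \<union> closure {z. g z \<noteq> 0}"
  proof
    fix z assume "z \<in> {z. c * f z + g z \<noteq> 0}"
    then have "f z \<noteq> 0 \<or> g z \<noteq> 0" by auto
    then show "z \<in> closure {z. f z \<noteq> 0} \<union> closure {z. g z \<noteq> 0}"
      using closure_subset[of "{z. f z \<noteq> 0}"] closure_subset[of "{z. g z \<noteq> 0}"] by blast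
  qed
  moreover have "bounded (closure {z. f z \<noteq> 0} \<union> closure {z. g z \<noteq> 0})"
    using assms by (simp add: test_functions_def compact_imp_bounded)
  ultimately have "compact (closure {z. c * f z + g z \<noteq> 0})"
    using bounded_subset compact_closure by blast
  then show ?thesis
    using assms by (simp add: test_functions_def Ck_add_mult)
qed

lemma dbar_add_mult:
  assumes "f \<in> test_functions" "g \<in> test_functions"
  shows "dbar (\<lambda>z. c * f z + g z) z = c * dbar f z + dbar g z"
  using partials_add_mult[OF test_functionD(1)[OF assms(1)] test_functionD(1)[OF assms(2)], of c z]
  by (simp add: dbar_def algebra_simps add_divide_distrib)

lemma integrable_continuous_compact_support:
  fixes f :: "'a::euclidean_space \<Rightarrow> 'b::{banach, second_countable_topology}"
  assumes "continuous_on UNIV f" "compact K" "\<And>x. x \<notin> K \<Longrightarrow> f x = 0"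
  shows "integrable lborel f"
proof -
  have "integrable lborel (\<lambda>x. indicator K x *\<^sub>R f x)"
    using assms by (intro borel_integrable_compact) (auto intro: continuous_on_subset)
  moreover have "(\<lambda>x. indicator K x *\<^sub>R f x) = f"
    using assms(3) by (auto simp: indicator_def fun_eq_iff)
  ultimately show ?thesis by simp
qed

lemma mixed_partials_eq:
  assumes "\<phi> \<in> test_functions"
  shows "partial_y (partial_x \<phi>) z = partial_x (partial_y \<phi>) z"
proof -
  note \<phi> = test_functionD[OF assms]
  have "Re \<i> *\<^sub>R partial_x (partial_x \<phi>) z + Im \<i> *\<^sub>R partial_y (partial_x \<phi>) z
      = Re 1 *\<^sub>R partial_x (partial_y \<phi>) z + Im 1 *\<^sub>R partial_y (partial_y \<phi>) z"
  proof (rule mixed_derivatives_eq[where h = 1 and k = \<i> and x = z and f = \<phi>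
      and f' = "\<lambda>z h. Re h *\<^sub>R partial_x \<phi> z + Im h *\<^sub>R partial_y \<phi> z"
      and g' = "\<lambda>z h. Re h *\<^sub>R partial_x (partial_x \<phi>) z + Im h *\<^sub>R partial_y (partial_x \<phi>) z"
      and k' = "\<lambda>z h. Re h *\<^sub>R partial_x (partial_y \<phi>) z + Im h *\<^sub>R partial_y (partial_y \<phi>) z"])
    show "(\<phi> has_derivative (\<lambda>h. Re h *\<^sub>R partial_x \<phi> z + Im h *\<^sub>R partial_y \<phi> z)) (at z)" for z
      by (rule has_derivative_partials) (rule \<phi>)
    show "((\<lambda>z. Re 1 *\<^sub>R partial_x \<phi> z + Im 1 *\<^sub>R partial_y \<phi> z) has_derivative
        (\<lambda>h. Re h *\<^sub>R partial_x (partial_x \<phi>) z + Im h *\<^sub>R partial_y (partial_x \<phi>) z)) (at z)" for z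
      using has_derivative_partials[OF \<phi>(3)] by simp
    show "((\<lambda>z. Re \<i> *\<^sub>R partial_x \<phi> z + Im \<i> *\<^sub>R partial_y \<phi> z) has_derivative
        (\<lambda>h. Re h *\<^sub>R partial_x (partial_y \<phi>) z + Im h *\<^sub>R partial_y (partial_y \<phi>) z)) (at z)" for z
      using has_derivative_partials[OF \<phi>(5)] by simp
  qed (use \<phi>(7,8) in \<open>simp_all add: continuous_on_eq_continuous_at\<close>)
  then show ?thesis by simp
qed

text \<open>The power e - 1 is split off as a quotient so that exponent \<epsilon> gives the product
  \<open>w z * s z\<close> of the main computation; exponent -1 gives the derivative of
  \<open>s\<close> itself.\<close>

lemma has_derivative_japanese_powr:
  "((\<lambda>z. (1 + (cmod z)\<^sup>2) powr e) has_derivative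
    (\<lambda>h. 2 * e * (Re z * Re h + Im z * Im h) * (1 + (cmod z)\<^sup>2) powr e * (1 / (1 + (cmod z)\<^sup>2)))) (at z)"
proof -
  have pos: "0 < 1 + (cmod z)\<^sup>2"
    by (simp add: add_pos_nonneg)
  have 1: "((\<lambda>z. 1 + (cmod z)\<^sup>2) has_derivative (\<lambda>h. 2 * (Re z * Re h + Im z * Im h))) (at z)"
    unfolding cmod_power2 by (auto intro!: derivative_eq_intros)
  have 2: "((\<lambda>t. t powr e) has_derivative (\<lambda>h. e * (1 + (cmod z)\<^sup>2) powr (e - 1) * h)) (at (1 + (cmod z)\<^sup>2))"
    using has_real_derivative_powr[OF pos, of e] by (simp add: has_field_derivative_def)
  have "(1 + (cmod z)\<^sup>2) powr (e - 1) = (1 + (cmod z)\<^sup>2) powr e * (1 / (1 + (cmod z)\<^sup>2))"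
    using pos by (simp add: powr_diff)
  then show ?thesis
    by (intro has_derivative_eq_rhs[OF has_derivative_compose[OF 1 2]]) (simp add: fun_eq_iff)
qed

lemma japanese_pos: "0 < japanese z"
  by (simp add: japanese_def add_pos_nonneg)

text \<open>Squaring removes the root in \<open>japanese\<close>; hence the squared norm of
  \<open>weight \<epsilon> f\<close> is the integral of |f|^2 exp \<psi>.\<close>

lemma weight_cmod_sq: "(cmod (weight \<theta> f z))\<^sup>2 = (1 + (cmod z)\<^sup>2) powr \<theta> * (cmod (f z))\<^sup>2"
proof -
  have "(japanese z powr \<theta>)\<^sup>2 = (japanese z powr 2) powr \<theta>"
    by (simp add: power2_eq_square powr_powr mult.commute flip: powr_add)
  also have "japanese z powr 2 = 1 + (cmod z)\<^sup>2"
    using japanese_pos[of z] by (simp add: japanese_def)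
  finally have "(japanese z powr \<theta>)\<^sup>2 = (1 + (cmod z)\<^sup>2) powr \<theta>"
    .
  then show ?thesis
    by (simp add: weight_def power_mult_distrib)
qed

subsection \<open>The weighted inequality\<close>

text \<open>Twice the divergence of \<open>(X, Y)\<close> in the proof below; \<open>x\<close>, \<open>y\<close> are the real coordinates of \<open>z\<close>,
  \<open>s = 1 / (1 + |z|\<^sup>2)\<close>, \<open>c\<close> is the mixed derivative of \<open>p\<close>, and primed variables stand for conjugates.\<close>

lemma dbar_divergence_identity:
  fixes p p' a a' b b' z z' w s e i x y c :: complex
  assumes "i * i = -1" "s * (1 + z * z') = 1" "2 * x = z + z'" "2 * i * y = z - z'"
  shows "2 * (i * (a' * b * w + p' * c * w + p' * b * (2 * e * x * w * s))
      - e * (p * p' * w * s + z' * (a * p' + p * a') * w * s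
        + z' * (p * p') * (2 * e * x * w * s * s - w * 2 * x * s * s)))
    - 2 * i * ((b' * a * w + p' * c * w + p' * a * (2 * e * y * w * s))
      + e * (- i * p * p' * w * s + z' * (b * p' + p * b') * w * s
        + z' * (p * p') * (2 * e * y * w * s * s - w * 2 * y * s * s)))
   = (a + i * b) * (a' - i * b') * w - 4 * e * w * (p * p') * s * s
      - (a - i * b + 2 * e * z' * s * p) * (a' + i * b' + 2 * e * z * s * p') * w"
  \<comment> \<open>With conjugates as independent variables this is a polynomial identity modulo
    the four relations.\<close>
  using assms by algebra

text \<open>The density \<open>E1 z - \<epsilon> * E2 z - E3 z\<close> is half the divergence of a
  compactly supported field (X, Y), hence has integral 0; the square \<open>E3\<close> is then
  discarded.\<close>

theorem weighted_dbar_inequality: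
  assumes \<phi>: "\<phi> \<in> test_functions"
  shows "\<epsilon> * sq_norm lborel (weight (\<epsilon> - 2) \<phi>) \<le> sq_norm lborel (weight \<epsilon> (dbar \<phi>))"
proof -
  obtain K where K: "compact K"
    and zero: "\<And>z. z \<notin> K \<Longrightarrow> \<phi> z = 0" "\<And>z. z \<notin> K \<Longrightarrow> partial_x \<phi> z = 0" "\<And>z. z \<notin> K \<Longrightarrow> partial_y \<phi> z = 0"
    using test_function_support[OF \<phi>] by metis
  have bdd: "bounded {z. \<phi> z \<noteq> 0}"
    using compact_imp_bounded[OF K] zero(1) by (auto elim!: bounded_subset)
  define a where "a = partial_x \<phi>"
  define b where "b = partial_y \<phi>"
  define c where "c = partial_y a"
  define w where "w z = (1 + (cmod z)\<^sup>2) powr \<epsilon>" for z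
  define s where "s z = 1 / (1 + (cmod z)\<^sup>2)" for z
  \<comment> \<open>One name for both mixed derivatives: they occur in the divergence with opposite
    signs and cancel.\<close>
  have cx: "partial_x b = c"
    using mixed_partials_eq[OF \<phi>] by (auto simp: a_def b_def c_def)
  note test = test_functionD[OF \<phi>, folded a_def b_def, folded c_def, unfolded cx]
  have nz: "1 + (cmod z)\<^sup>2 \<noteq> 0" for z
    by (metis add_pos_nonneg less_irrefl zero_le_power2 zero_less_one)
  have cont [continuous_intros]: "continuous_on UNIV \<phi>" "continuous_on UNIV a" "continuous_on UNIV b"
    "continuous_on UNIV c" "continuous_on UNIV w" "continuous_on UNIV s"
    using test nz unfolding w_def s_def by (auto intro!: continuous_intros)
  have d\<phi>: "(\<phi> has_derivative (\<lambda>h. Re h *\<^sub>R a z + Im h *\<^sub>R b z)) (at z)" for z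
    unfolding a_def b_def by (rule has_derivative_partials) (rule test)
  have da: "(a has_derivative (\<lambda>h. Re h *\<^sub>R partial_x a z + Im h *\<^sub>R c z)) (at z)" for z
    unfolding c_def by (rule has_derivative_partials) (rule test)
  have db: "(b has_derivative (\<lambda>h. Re h *\<^sub>R c z + Im h *\<^sub>R partial_y b z)) (at z)" for z
    unfolding cx[symmetric] by (rule has_derivative_partials) (rule test)
  have dw: "(w has_derivative (\<lambda>h. 2 * \<epsilon> * (Re z * Re h + Im z * Im h) * w z * s z)) (at z)" for z
    unfolding w_def s_def by (rule has_derivative_japanese_powr)
  have ds: "(s has_derivative (\<lambda>h. - 2 * (Re z * Re h + Im z * Im h) * s z * s z)) (at z)" for z
  proof -
    have "s = (\<lambda>z. (1 + (cmod z)\<^sup>2) powr (-1))"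
      by (simp add: s_def fun_eq_iff powr_minus_divide add_nonneg_nonneg)
    then show ?thesis
      using has_derivative_japanese_powr[of "-1" z] by (simp add: s_def)
  qed
  \<comment> \<open>Since the z-derivative of \<open>w\<close> is \<epsilon> conj(z) w s,
    \<open>F\<close> is |\<phi>|^2 times that derivative. In (X, Y) the terms with \<open>b\<close>
    and \<open>a\<close> are a multiple of the divergence-free field (b, -a) and produce |dbar
    \<phi>|^2 minus the squared z-derivative of \<phi>, up to derivatives of \<open>w\<close>. The
    terms with \<open>F\<close> contribute -2 dbar F, which completes the square and brings in the
    curvature of the weight.\<close>
  define F where "F z = of_real \<epsilon> * cnj z * (\<phi> z * cnj (\<phi> z)) * of_real (w z) * of_real (s z)" for z
  define X where "X z = \<i> * cnj (\<phi> z) * b z * of_real (w z) - F z" for z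
  define Y where "Y z = - \<i> * (cnj (\<phi> z) * a z * of_real (w z) + F z)" for z
  \<comment> \<open>\<open>d h\<close> is the derivative of \<phi> in direction \<open>h\<close>,
    and \<open>2 * l h z\<close> that of |z|^2.\<close>
  define d where "d h z = Re h *\<^sub>R a z + Im h *\<^sub>R b z" for h z
  define l where "l h z = Re z * Re h + Im z * Im h" for h z :: complex
  define F' where "F' z h = of_real \<epsilon> * (cnj h * \<phi> z * cnj (\<phi> z) * of_real (w z) * of_real (s z)
      + cnj z * (d h z * cnj (\<phi> z) + \<phi> z * cnj (d h z)) * of_real (w z) * of_real (s z)
      + cnj z * (\<phi> z * cnj (\<phi> z)) * of_real (2 * \<epsilon> * l h z * w z * s z * s z - w z * 2 * l h z * s z * s z))" for z h
  define X' where "X' z h = \<i> * (cnj (d h z) * b z * of_real (w z)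
      + cnj (\<phi> z) * (Re h *\<^sub>R c z + Im h *\<^sub>R partial_y b z) * of_real (w z)
      + cnj (\<phi> z) * b z * of_real (2 * \<epsilon> * l h z * w z * s z)) - F' z h" for z h
  define Y' where "Y' z h = - \<i> * (cnj (d h z) * a z * of_real (w z)
      + cnj (\<phi> z) * (Re h *\<^sub>R partial_x a z + Im h *\<^sub>R c z) * of_real (w z)
      + cnj (\<phi> z) * a z * of_real (2 * \<epsilon> * l h z * w z * s z) + F' z h)" for z h
  have dF: "(F has_derivative F' z) (at z)" for z
    unfolding F_def F'_def d_def l_def
    by (rule has_derivative_eq_rhs, (rule derivative_intros d\<phi> dw ds)+) (simp add: fun_eq_iff algebra_simps)
  have dX: "(X has_derivative X' z) (at z)" for z
    unfolding X_def X'_def d_def l_def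
    by (rule has_derivative_eq_rhs, (rule derivative_intros d\<phi> db dw dF)+) (simp add: fun_eq_iff algebra_simps)
  have dY: "(Y has_derivative Y' z) (at z)" for z
    unfolding Y_def Y'_def d_def l_def
    by (rule has_derivative_eq_rhs, (rule derivative_intros d\<phi> da dw dF)+) (simp add: fun_eq_iff algebra_simps)
  have contd: "continuous_on UNIV (\<lambda>z. d h z)" for h
    unfolding d_def by (intro continuous_on_add continuous_on_scaleR continuous_on_const cont)
  have contl: "continuous_on UNIV (\<lambda>z. l h z)" for h
    unfolding l_def by (intro continuous_on_add continuous_on_mult continuous_on_const
        continuous_on_Re continuous_on_Im continuous_on_id)
  note cont_rules = continuous_on_add continuous_on_mult continuous_on_const continuous_on_diff
    continuous_on_minus continuous_on_cnj continuous_on_of_real continuous_on_id cont contd contl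
  have contF: "continuous_on UNIV (\<lambda>z. F' z h)" for h
    unfolding F'_def by (intro cont_rules)
  \<comment> \<open>In direction 1 the coefficient of \<open>partial_y b\<close> is zero, so
    \<open>c\<close> is the only second derivative left; the same happens to
    \<open>partial_x a\<close> for \<open>Y'\<close> in direction \<i>.\<close>
  have contX: "continuous_on UNIV (\<lambda>z. X' z 1)"
    unfolding X'_def by (simp, intro cont_rules contF)
  have contY: "continuous_on UNIV (\<lambda>z. Y' z \<i>)"
    unfolding Y'_def by (simp, intro cont_rules contF)
  have "integral\<^sup>L lborel (\<lambda>z. X' z 1) = 0"
    by (rule integral_derivative_eq_0[OF dX contX])
      (auto simp: X_def F_def intro!: bounded_subset[OF bdd])
  moreover have "integral\<^sup>L lborel (\<lambda>z. Y' z \<i>) = 0"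
    by (rule integral_derivative_eq_0[OF dY contY])
      (auto simp: Y_def F_def intro!: bounded_subset[OF bdd])
  moreover have intX: "integrable lborel (\<lambda>z. X' z 1)"
    by (rule integrable_continuous_compact_support[OF contX K])
      (simp add: X'_def F'_def d_def zero a_def b_def)
  moreover have intY: "integrable lborel (\<lambda>z. Y' z \<i>)"
    by (rule integrable_continuous_compact_support[OF contY K])
      (simp add: Y'_def F'_def d_def zero a_def b_def)
  ultimately have int0: "(\<integral>z. X' z 1 + Y' z \<i> \<partial>lborel) = 0"
    by simp
  \<comment> \<open>The three densities of the integrated identity. The quarter in \<open>E3\<close>
    comes from the z-derivative of \<phi> being (a - \<i> b) / 2.\<close>
  define E1 where "E1 z = w z * (cmod (dbar \<phi> z))\<^sup>2" for z
  define E2 where "E2 z = (1 + (cmod z)\<^sup>2) powr (\<epsilon> - 2) * (cmod (\<phi> z))\<^sup>2" for z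
  define E3 where "E3 z = (cmod (a z - \<i> * b z + 2 * of_real \<epsilon> * cnj z * of_real (s z) * \<phi> z))\<^sup>2 * w z / 4" for z
  have sqc: "of_real ((cmod u)\<^sup>2) = u * cnj u" for u
    using complex_norm_square[of u] by simp
  have identity: "X' z 1 + Y' z \<i> = 2 * of_real (E1 z - \<epsilon> * E2 z - E3 z)" for z
  proof -
    have s1: "of_real (s z) * (1 + z * cnj z) = 1"
    proof -
      have "of_real (s z * (1 + (cmod z)\<^sup>2)) = (1 :: complex)"
        using nz[of z] by (simp add: s_def)
      then show ?thesis by (simp only: of_real_mult of_real_add sqc of_real_1)
    qed
    have "(1 + (cmod z)\<^sup>2) powr (\<epsilon> - 2) = w z * s z * s z"
      using nz[of z] by (simp add: w_def s_def powr_diff power2_eq_square add_pos_nonneg)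
    then have E2: "of_real (E2 z) = of_real (w z) * (\<phi> z * cnj (\<phi> z)) * of_real (s z) * of_real (s z)"
      by (simp only: E2_def of_real_mult sqc mult_ac)
    have E1: "4 * of_real (E1 z) = (a z + \<i> * b z) * (cnj (a z) - \<i> * cnj (b z)) * of_real (w z)"
      by (simp only: E1_def of_real_mult sqc) (simp add: dbar_def a_def b_def field_simps)
    have E3: "4 * of_real (E3 z) = (a z - \<i> * b z + 2 * of_real \<epsilon> * cnj z * of_real (s z) * \<phi> z)
        * (cnj (a z) + \<i> * cnj (b z) + 2 * of_real \<epsilon> * z * of_real (s z) * cnj (\<phi> z)) * of_real (w z)"
      by (simp only: E3_def of_real_mult of_real_divide sqc) (simp add: field_simps)
    have re: "2 * of_real (Re z) = z + cnj z" "2 * \<i> * of_real (Im z) = z - cnj z"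
      by (simp_all add: complex_eq_iff)
    have "2 * (X' z 1 + Y' z \<i>) = 4 * of_real (E1 z - \<epsilon> * E2 z - E3 z)"
      using dbar_divergence_identity[OF _ s1 re, of "cnj (a z)" "b z" "of_real (w z)" "cnj (\<phi> z)" "c z" "of_real \<epsilon>" "\<phi> z" "a z" "cnj (b z)"]
      unfolding of_real_diff right_diff_distrib E1 E3
      by (simp add: E2 X'_def Y'_def F'_def d_def l_def field_simps)
    then show ?thesis by algebra
  qed
  have cE: "continuous_on UNIV E1" "continuous_on UNIV E2" "continuous_on UNIV E3"
    unfolding E1_def E2_def E3_def dbar_def a_def[symmetric] b_def[symmetric]
    using nz by (auto intro!: continuous_intros cont)
  have int: "integrable lborel E1" "integrable lborel E2" "integrable lborel E3"
    by (rule integrable_continuous_compact_support[OF cE(1) K], simp add: E1_def dbar_def zero)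
      (rule integrable_continuous_compact_support[OF cE(2) K], simp add: E2_def zero,
       rule integrable_continuous_compact_support[OF cE(3) K], simp add: E3_def a_def b_def zero)
  have "2 * of_real (\<integral>z. E1 z - \<epsilon> * E2 z - E3 z \<partial>lborel) = (0 :: complex)"
    using int0 by (simp only: identity integral_mult_right_zero integral_complex_of_real)
  then have "(\<integral>z. E1 z - \<epsilon> * E2 z - E3 z \<partial>lborel) = 0"
    by (simp only: mult_eq_0_iff of_real_eq_0_iff) simp
  then have "integral\<^sup>L lborel E1 - \<epsilon> * integral\<^sup>L lborel E2 = integral\<^sup>L lborel E3"
    using int by simp
  moreover have "0 \<le> integral\<^sup>L lborel E3"
    by (rule Bochner_Integration.integral_nonneg) (simp add: E3_def w_def)
  ultimately show ?thesis
    unfolding sq_norm_def weight_cmod_sq E1_def E2_def w_def by simp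
qed

subsection \<open>Existence of the solution\<close>

lemma L2_iff: "f \<in> L2 \<longleftrightarrow> square_integrable lebesgue f"
  by (simp add: L2_def square_integrable_def)

lemma L2_norm_eq: "L2_norm f = sqrt (sq_norm lebesgue f)"
  by (simp add: L2_norm_def sq_norm_def)

lemma weight_weight: "weight \<theta> (weight \<eta> f) = weight (\<theta> + \<eta>) f"
  using japanese_pos by (simp add: weight_def powr_add)

lemma weight_0: "weight 0 f = f"
  using japanese_pos by (simp add: weight_def less_imp_neq[symmetric])

lemma weight_mult_left: "weight \<theta> f z * g z = f z * weight \<theta> g z"
  by (simp add: weight_def)

lemma continuous_on_japanese_powr: "continuous_on S (\<lambda>z. japanese z powr \<theta>)"
  using japanese_pos unfolding japanese_def
  by (intro continuous_intros) (metis less_irrefl)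

text \<open>Continuity gives Borel measurability, and completing the measure leaves integrals of
  Borel functions unchanged. This carries the weighted inequality from \<open>lborel\<close> to
  \<open>lebesgue\<close>.\<close>

lemma square_integrable_continuous_compact_support:
  fixes f :: "complex \<Rightarrow> complex"
  assumes cont: "continuous_on UNIV f" and K: "compact K" and zero: "\<And>z. z \<notin> K \<Longrightarrow> f z = 0"
  shows "square_integrable lebesgue f" "sq_norm lebesgue f = sq_norm lborel f"
proof -
  have m: "f \<in> borel_measurable lborel"
    using borel_measurable_continuous_onI[OF cont] by simp
  then have m2: "(\<lambda>z. (cmod (f z))\<^sup>2) \<in> borel_measurable lborel"
    by measurable
  have "integrable lborel (\<lambda>z. (cmod (f z))\<^sup>2)"
    by (rule integrable_continuous_compact_support[OF _ K])
      (auto intro!: continuous_on_power continuous_on_norm cont simp: zero)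
  with m m2 show "square_integrable lebesgue f"
    by (simp add: square_integrable_def measurable_completion integrable_completion)
  show "sq_norm lebesgue f = sq_norm lborel f"
    unfolding sq_norm_def by (rule integral_completion[OF m2])
qed

lemma square_integrable_weight_test_function:
  assumes \<phi>: "\<phi> \<in> test_functions"
  shows "square_integrable lebesgue (weight \<theta> \<phi>)"
    "sq_norm lebesgue (weight \<theta> \<phi>) = sq_norm lborel (weight \<theta> \<phi>)"
    "square_integrable lebesgue (weight \<theta> (dbar \<phi>))"
    "sq_norm lebesgue (weight \<theta> (dbar \<phi>)) = sq_norm lborel (weight \<theta> (dbar \<phi>))"
proof -
  obtain K where K: "compact K" "\<And>z. z \<notin> K \<Longrightarrow> \<phi> z = 0 \<and> partial_x \<phi> z = 0 \<and> partial_y \<phi> z = 0"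
    using test_function_support[OF \<phi>] by blast
  have cont: "continuous_on UNIV (weight \<theta> \<phi>)" "continuous_on UNIV (weight \<theta> (dbar \<phi>))"
    unfolding weight_def dbar_def
    by (intro continuous_intros continuous_on_japanese_powr test_functionD[OF \<phi>]; simp)+
  have "weight \<theta> \<phi> z = 0" "weight \<theta> (dbar \<phi>) z = 0" if "z \<notin> K" for z
    using K(2)[OF that] by (simp_all add: weight_def dbar_def)
  then show "square_integrable lebesgue (weight \<theta> \<phi>)"
    "sq_norm lebesgue (weight \<theta> \<phi>) = sq_norm lborel (weight \<theta> \<phi>)"
    "square_integrable lebesgue (weight \<theta> (dbar \<phi>))"
    "sq_norm lebesgue (weight \<theta> (dbar \<phi>)) = sq_norm lborel (weight \<theta> (dbar \<phi>))"
    using square_integrable_continuous_compact_support[OF cont(1) K(1)]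
      square_integrable_continuous_compact_support[OF cont(2) K(1)] by auto
qed

text \<open>On a compact set the weight is bounded, so its truncation is square integrable and its
  product with \<open>f\<close> is integrable.\<close>

lemma locally_integrable_weight:
  assumes f: "square_integrable lebesgue f"
  shows "locally_integrable (weight \<theta> f)"
  unfolding locally_integrable_def
proof (intro allI impI)
  fix K :: "complex set" assume K: "compact K"
  define h where "h z = complex_of_real (indicator K z * japanese z powr \<theta>)" for z
  have [measurable]: "(\<lambda>z. japanese z powr \<theta>) \<in> borel_measurable borel"
    by (rule borel_measurable_continuous_onI) (rule continuous_on_japanese_powr)
  have [measurable]: "K \<in> sets borel"
    using K by (simp add: borel_compact)
  have "integrable lborel (\<lambda>z. indicator K z *\<^sub>R (japanese z powr \<theta>)\<^sup>2)"
    by (rule borel_integrable_compact[OF K]) (intro continuous_on_power continuous_on_japanese_powr)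
  moreover have "(\<lambda>z. indicator K z *\<^sub>R (japanese z powr \<theta>)\<^sup>2) = (\<lambda>z. (cmod (h z))\<^sup>2)"
    by (auto simp: h_def indicator_def)
  ultimately have "integrable lborel (\<lambda>z. (cmod (h z))\<^sup>2)" by simp
  moreover have hm [measurable]: "h \<in> borel_measurable lborel"
    unfolding h_def by measurable
  moreover have "(\<lambda>z. (cmod (h z))\<^sup>2) \<in> borel_measurable lborel" by measurable
  ultimately have "square_integrable lebesgue h"
    by (simp add: square_integrable_def measurable_completion integrable_completion)
  from integrable_mult_square_integrable[OF this f]
  show "set_integrable lebesgue K (weight \<theta> f)"
    by (simp add: set_integrable_def h_def weight_def scaleR_conv_of_real mult.assoc)
qed

lemma zero_test_function: "(\<lambda>_. 0) \<in> test_functions"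
proof -
  have "partial_x (\<lambda>_. 0) = (\<lambda>_. 0)" "partial_y (\<lambda>_. 0) = (\<lambda>_. 0)"
    by (simp_all add: partial_x_def partial_y_def fun_eq_iff)
  then have "Ck k (\<lambda>_. 0)" for k
    by (induction k) auto
  then show ?thesis by (simp add: test_functions_def)
qed

theorem proposition2p1:
  fixes \<epsilon> :: real
  assumes "\<epsilon> > 0"
  shows "\<forall>v \<in> weighted_L2 (\<epsilon> - 2). \<exists>u \<in> weighted_L2 \<epsilon>.
           dbar_distributional u v \<and>
           L2_norm (weight (- \<epsilon>) u) \<le> \<epsilon> powr (- 1 / 2) * L2_norm (weight (2 - \<epsilon>) v)"
proof
  fix v assume "v \<in> weighted_L2 (\<epsilon> - 2)"
  then obtain f where v: "v = weight (\<epsilon> - 2) f" and f: "square_integrable lebesgue f"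
    by (auto simp: weighted_L2_def L2_iff)
  \<comment> \<open>The weight is absorbed into the functions, so the Riesz theorem is used in
    unweighted L2. That the second component depends only on the first follows from the bound shown
    below.\<close>
  define G where "G = (\<lambda>\<phi>. (weight \<epsilon> (dbar \<phi>), - (\<integral>z. v z * \<phi> z \<partial>lebesgue))) ` test_functions"
  define C where "C = \<epsilon> powr (- 1 / 2) * sqrt (sq_norm lebesgue f)"
  \<comment> \<open>Moving the weight from \<open>v\<close> to \<phi> pairs \<open>f\<close> with
    exactly the norm controlled by the weighted inequality.\<close>
  have v\<phi>: "v z * \<phi> z = f z * weight (\<epsilon> - 2) \<phi> z" for \<phi> z
    by (simp add: v weight_mult_left)
  have int: "integrable lebesgue (\<lambda>z. v z * \<phi> z)" if "\<phi> \<in> test_functions" for \<phi>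
    unfolding v\<phi> using f square_integrable_weight_test_function(1)[OF that]
    by (rule integrable_mult_square_integrable)
  obtain g where g: "square_integrable lebesgue g" "sqrt (sq_norm lebesgue g) \<le> C"
    and rep: "\<And>h c. (h, c) \<in> G \<Longrightarrow> (\<integral>z. g z * h z \<partial>lebesgue) = c"
  proof (rule Riesz_representation_linear_relation[of G lebesgue C])
    show "square_integrable lebesgue h" if "(h, c) \<in> G" for h c
      using that square_integrable_weight_test_function(3) by (auto simp: G_def)
    show "(\<lambda>z. a * h z + k z, a * c + d) \<in> G" if hk: "(h, c) \<in> G" "(k, d) \<in> G" for a h c k d
    proof -
      obtain \<phi> where \<phi>: "\<phi> \<in> test_functions" "h = weight \<epsilon> (dbar \<phi>)" "c = - (\<integral>z. v z * \<phi> z \<partial>lebesgue)"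
        using hk(1) by (auto simp: G_def)
      obtain \<psi> where \<psi>: "\<psi> \<in> test_functions" "k = weight \<epsilon> (dbar \<psi>)" "d = - (\<integral>z. v z * \<psi> z \<partial>lebesgue)"
        using hk(2) by (auto simp: G_def)
      have "weight \<epsilon> (dbar (\<lambda>z. a * \<phi> z + \<psi> z)) = (\<lambda>z. a * h z + k z)"
        by (simp add: dbar_add_mult \<phi> \<psi> fun_eq_iff weight_def scaleR_add_right)
      moreover have "(\<integral>z. v z * (a * \<phi> z + \<psi> z) \<partial>lebesgue) = (\<integral>z. a * (v z * \<phi> z) + v z * \<psi> z \<partial>lebesgue)"
        by (simp add: algebra_simps)
      then have "- (\<integral>z. v z * (a * \<phi> z + \<psi> z) \<partial>lebesgue) = a * c + d"
        using int[OF \<phi>(1)] int[OF \<psi>(1)] by (simp add: \<phi>(3) \<psi>(3))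
      ultimately show ?thesis
        unfolding G_def using test_functions_add_mult[OF \<phi>(1) \<psi>(1), of a]
        by (auto intro!: rev_image_eqI)
    qed
    show "cmod c \<le> C * sqrt (sq_norm lebesgue h)" if hc: "(h, c) \<in> G" for h c
    proof -
      obtain \<phi> where \<phi>: "\<phi> \<in> test_functions" "h = weight \<epsilon> (dbar \<phi>)" "c = - (\<integral>z. v z * \<phi> z \<partial>lebesgue)"
        using hc by (auto simp: G_def)
      note sq = square_integrable_weight_test_function[OF \<phi>(1)]
      have "cmod c = cmod (\<integral>z. f z * weight (\<epsilon> - 2) \<phi> z \<partial>lebesgue)"
        by (simp add: \<phi>(3) v\<phi>)
      also have "\<dots> \<le> sqrt (sq_norm lebesgue f) * sqrt (sq_norm lebesgue (weight (\<epsilon> - 2) \<phi>))"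
        by (rule integral_Cauchy_Schwarz[OF f sq(1)])
      \<comment> \<open>The weighted inequality enters here, and its factor \<epsilon> becomes the
        constant \<epsilon>^(-1/2).\<close>
      also have "\<dots> \<le> sqrt (sq_norm lebesgue f) * sqrt (sq_norm lebesgue h / \<epsilon>)"
        using weighted_dbar_inequality[OF \<phi>(1), of \<epsilon>] \<open>\<epsilon> > 0\<close>
        by (intro mult_left_mono) (simp_all add: \<phi>(2) sq pos_le_divide_eq mult.commute)
      also have "\<dots> = C * sqrt (sq_norm lebesgue h)"
        using \<open>\<epsilon> > 0\<close> by (simp add: C_def real_sqrt_divide powr_minus_divide powr_half_sqrt)
      finally show ?thesis .
    qed
    show "(\<lambda>_. 0, 0) \<in> G"
    proof -
      have "weight \<epsilon> (dbar (\<lambda>_. 0)) = (\<lambda>_. 0)"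
        by (simp add: weight_def dbar_def partial_x_def partial_y_def fun_eq_iff)
      then show ?thesis
        unfolding G_def by (intro rev_image_eqI[OF zero_test_function]) simp
    qed
  qed (simp_all add: C_def)
  show "\<exists>u \<in> weighted_L2 \<epsilon>. dbar_distributional u v \<and>
      L2_norm (weight (- \<epsilon>) u) \<le> \<epsilon> powr (- 1 / 2) * L2_norm (weight (2 - \<epsilon>) v)"
  proof (intro bexI conjI)
    show "weight \<epsilon> g \<in> weighted_L2 \<epsilon>"
      using g(1) by (simp add: weighted_L2_def L2_iff)
    \<comment> \<open>Moving the weight from \<open>dbar \<phi>\<close> back to \<open>g\<close>
      turns the Riesz identity into the weak equation for the solution
      \<open>weight \<epsilon> g\<close>.\<close>
    have "(\<integral>z. weight \<epsilon> g z * dbar \<phi> z \<partial>lebesgue) = - (\<integral>z. v z * \<phi> z \<partial>lebesgue)"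
      if "\<phi> \<in> test_functions" for \<phi>
      using that rep by (auto simp: G_def weight_mult_left)
    then show "dbar_distributional (weight \<epsilon> g) v"
      by (simp add: dbar_distributional_def v locally_integrable_weight f g)
    show "L2_norm (weight (- \<epsilon>) (weight \<epsilon> g)) \<le> \<epsilon> powr (- 1 / 2) * L2_norm (weight (2 - \<epsilon>) v)"
      using g(2) by (simp add: C_def v L2_norm_eq weight_weight weight_0)
  qed
qed

end
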